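(* Let $\mathcal{R}$ be a set of $n$ intervals of ply $\Delta$. There exists a sorting-supersequence $\Xi$ of $\mathcal{R}$ of size $O(n\Delta^2)$. Furthermore, such a sequence can be computed in $O(n(\Delta^2 + \log n))$ time.
   Context: Let $\mathcal{R}=\{R_1,\dots,R_n\}$ be a set of intervals on the real line. A realization of $\mathcal{R}$ is a point set $P=\{p_1,\dots,p_n\}$ with $p_i\in R_i$ for each $i$. The ply $\Delta$ of $\mathcal{R}$ is the maximum, over all $p\in\mathbb{R}$, of the number of intervals of $\mathcal{R}$ containing $p$. A sorting-supersequence of $\mathcal{R}$ is a sequence $\Xi$ of (possibly reoccurring) intervals of $\mathcal{R}$ such that, for any realization $P$ of $\mathcal{R}$, the sorted order of $P$ (written as the sequence of corresponding intervals) is a subsequence of $\Xi$. *)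

theory Defs
  imports "HOL-Analysis.Analysis" "HOL-Library.Sublist"
begin

section \<open>Intervals, ply and sorting-supersequences\<close>

text \<open>A family \<open>R 0, \<dots>, R (n - 1)\<close> of intervals is identified with its indices, so that a sequence
  of (possibly reoccurring) intervals of the family is a list of numbers below \<open>n\<close>.\<close>

definition realization :: "nat \<Rightarrow> (nat \<Rightarrow> real set) \<Rightarrow> (nat \<Rightarrow> real) \<Rightarrow> bool" where
  "realization n R p \<longleftrightarrow> (\<forall>i<n. p i \<in> R i)"

definition ply :: "nat \<Rightarrow> (nat \<Rightarrow> real set) \<Rightarrow> nat" where
  "ply n R = Max (range (\<lambda>x. card {i. i < n \<and> x \<in> R i}))"

text \<open>Cond points coincide, every way of breaking the ties is a sorted order.\<close>

definition sorted_order :: "nat \<Rightarrow> (nat \<Rightarrow> real) \<Rightarrow> nat list \<Rightarrow> bool" where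
  "sorted_order n p \<sigma> \<longleftrightarrow> distinct \<sigma> \<and> set \<sigma> = {..<n} \<and> sorted (map p \<sigma>)"

definition sorting_supersequence :: "nat \<Rightarrow> (nat \<Rightarrow> real set) \<Rightarrow> nat list \<Rightarrow> bool" where
  "sorting_supersequence n R \<Xi> \<longleftrightarrow>
     set \<Xi> \<subseteq> {..<n} \<and>
     (\<forall>p \<sigma>. realization n R p \<and> sorted_order n p \<sigma> \<longrightarrow> subseq \<sigma> \<Xi>)"

section \<open>Finite descriptions of intervals\<close>

datatype bound = Unbounded | Closed real | Open real

fun above :: "bound \<Rightarrow> real set" where
  "above Unbounded = UNIV"
| "above (Closed a) = {a..}"
| "above (Open a) = {a<..}"

fun below :: "bound \<Rightarrow> real set" where
  "below Unbounded = UNIV"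
| "below (Closed b) = {..b}"
| "below (Open b) = {..<b}"

definition ivl_set :: "bound \<times> bound \<Rightarrow> real set" where
  "ivl_set I = above (fst I) \<inter> below (snd I)"

lemma is_interval_ivl_set: "is_interval (ivl_set I)"
  unfolding ivl_set_def
  by (cases "fst I"; cases "snd I") (auto simp: is_interval_1)

lemma is_interval_imp_ivl_set:
  fixes S :: "real set"
  assumes S: "is_interval S" and ne: "S \<noteq> {}"
  shows "\<exists>I. S = ivl_set I"
proof -
  have mid: "z \<in> S" if "x \<in> S" "y \<in> S" "x \<le> z" "z \<le> y" for x y z
    using S that unfolding is_interval_1 by blast
  have "\<exists>l. S \<subseteq> above l \<and> (\<forall>z\<in>above l. \<exists>x\<in>S. x \<le> z)"
  proof (cases "bdd_below S")
    case True
    have ge: "\<And>x. x \<in> S \<Longrightarrow> Inf S \<le> x"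
      using True by (simp add: cInf_lower)
    have lt: "\<exists>x\<in>S. x \<le> z" if "Inf S < z" for z
      using that ne True by (metis cInf_less_iff less_imp_le)
    show ?thesis
    proof (cases "Inf S \<in> S")
      case True
      then show ?thesis using ge by (intro exI[of _ "Closed (Inf S)"]) auto
    next
      case False
      then have sub: "S \<subseteq> {Inf S<..}" using ge by (force simp: less_le)
      show ?thesis using sub lt by (intro exI[of _ "Open (Inf S)"]) simp
    qed
  next
    case False
    then show ?thesis
      by (intro exI[of _ Unbounded]) (simp add: bdd_below_def, meson linear)
  qed
  then obtain l where l: "S \<subseteq> above l" "\<And>z. z \<in> above l \<Longrightarrow> \<exists>x\<in>S. x \<le> z" by blast
  have "\<exists>u. S \<subseteq> below u \<and> (\<forall>z\<in>below u. \<exists>x\<in>S. z \<le> x)"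
  proof (cases "bdd_above S")
    case True
    have ge: "\<And>x. x \<in> S \<Longrightarrow> x \<le> Sup S"
      using True by (simp add: cSup_upper)
    have lt: "\<exists>x\<in>S. z \<le> x" if "z < Sup S" for z
      using that ne True by (metis less_cSup_iff less_imp_le)
    show ?thesis
    proof (cases "Sup S \<in> S")
      case True
      then show ?thesis using ge by (intro exI[of _ "Closed (Sup S)"]) auto
    next
      case False
      then have sub: "S \<subseteq> {..<Sup S}" using ge by (force simp: less_le)
      show ?thesis using sub lt by (intro exI[of _ "Open (Sup S)"]) simp
    qed
  next
    case False
    then show ?thesis
      by (intro exI[of _ Unbounded]) (simp add: bdd_above_def, meson linear)
  qed
  then obtain u where u: "S \<subseteq> below u" "\<And>z. z \<in> below u \<Longrightarrow> \<exists>x\<in>S. z \<le> x" by blast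
  have "S = ivl_set (l, u)"
    using l u mid by (auto simp: ivl_set_def) blast
  then show ?thesis ..
qed

section \<open>A comparison-based real RAM\<close>

text \<open>
  A structured random-access machine with a read-only memory of real numbers. Reals can only be
  compared, so every instruction is also one of the usual real RAM. There are natural-number
  registers, natural-number memories with indirect addressing (both selected by constants
  occurring in the program) and a write-only output tape. Arithmetic is restricted to addition and
  truncated subtraction, and every node of an expression that is evaluated costs one time unit.
\<close>

datatype aexp =
    Const nat
  | Reg nat
  | Load nat aexp \<comment> \<open>memory, address\<close>
  | Plus aexp aexp
  | Minus aexp aexp

datatype bexp =
    Less aexp aexp
  | RLess aexp aexp \<comment> \<open>compares the reals stored at the two addresses\<close>
  | Neg bexp
  | Conj bexp bexp

datatype com =
    Skip
  | Assign nat aexp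
  | Store nat aexp aexp \<comment> \<open>memory, address, value\<close>
  | Emit aexp
  | Seq com com
  | Cond bexp com com
  | While bexp com

record ram =
  reg :: "nat \<Rightarrow> nat"
  mem :: "nat \<Rightarrow> nat \<Rightarrow> nat"
  tape :: "nat list"

primrec aval :: "aexp \<Rightarrow> ram \<Rightarrow> nat" where
  "aval (Const k) s = k"
| "aval (Reg r) s = reg s r"
| "aval (Load m a) s = mem s m (aval a s)"
| "aval (Plus a b) s = aval a s + aval b s"
| "aval (Minus a b) s = aval a s - aval b s"

primrec acost :: "aexp \<Rightarrow> nat" where
  "acost (Const k) = 1"
| "acost (Reg r) = 1"
| "acost (Load m a) = acost a + 1"
| "acost (Plus a b) = acost a + acost b + 1"
| "acost (Minus a b) = acost a + acost b + 1"

primrec bval :: "(nat \<Rightarrow> real) \<Rightarrow> bexp \<Rightarrow> ram \<Rightarrow> bool" where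
  "bval X (Less a b) s \<longleftrightarrow> aval a s < aval b s"
| "bval X (RLess a b) s \<longleftrightarrow> X (aval a s) < X (aval b s)"
| "bval X (Neg b) s \<longleftrightarrow> \<not> bval X b s"
| "bval X (Conj b c) s \<longleftrightarrow> bval X b s \<and> bval X c s"

primrec bcost :: "bexp \<Rightarrow> nat" where
  "bcost (Less a b) = acost a + acost b + 1"
| "bcost (RLess a b) = acost a + acost b + 1"
| "bcost (Neg b) = bcost b + 1"
| "bcost (Conj b c) = bcost b + bcost c + 1"

text \<open>\<open>exec X c s t s'\<close>: with real memory \<open>X\<close>, the program \<open>c\<close> started in \<open>s\<close> terminates in \<open>s'\<close>
  after exactly \<open>t\<close> time units.\<close>

inductive exec :: "(nat \<Rightarrow> real) \<Rightarrow> com \<Rightarrow> ram \<Rightarrow> nat \<Rightarrow> ram \<Rightarrow> bool" for X where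
  Skip: "exec X Skip s 1 s"
| Assign: "exec X (Assign r a) s (acost a + 1) (s\<lparr>reg := (reg s)(r := aval a s)\<rparr>)"
| Store: "exec X (Store m a b) s (acost a + acost b + 1)
    (s\<lparr>mem := (mem s)(m := (mem s m)(aval a s := aval b s))\<rparr>)"
| Emit: "exec X (Emit a) s (acost a + 1) (s\<lparr>tape := tape s @ [aval a s]\<rparr>)"
| Seq: "exec X c s t s' \<Longrightarrow> exec X d s' t' s'' \<Longrightarrow> exec X (Seq c d) s (t + t') s''"
| CondTrue: "bval X b s \<Longrightarrow> exec X c s t s' \<Longrightarrow> exec X (Cond b c d) s (bcost b + t + 1) s'"
| CondFalse: "\<not> bval X b s \<Longrightarrow> exec X d s t s' \<Longrightarrow> exec X (Cond b c d) s (bcost b + t + 1) s'"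
| WhileFalse: "\<not> bval X b s \<Longrightarrow> exec X (While b c) s (bcost b + 1) s"
| WhileTrue: "bval X b s \<Longrightarrow> exec X c s t s' \<Longrightarrow> exec X (While b c) s' t' s'' \<Longrightarrow>
    exec X (While b c) s (bcost b + t + t' + 1) s''"

inductive_cases exec_SkipE: "exec X Skip s t s'"
inductive_cases exec_AssignE: "exec X (Assign r a) s t s'"
inductive_cases exec_StoreE: "exec X (Store m a b) s t s'"
inductive_cases exec_EmitE: "exec X (Emit a) s t s'"
inductive_cases exec_SeqE: "exec X (Seq c d) s t s'"
inductive_cases exec_CondE: "exec X (Cond b c d) s t s'"
inductive_cases exec_WhileE: "exec X (While b c) s t s'"

lemma exec_deterministic:
  "exec X c s t s' \<Longrightarrow> exec X c s u s'' \<Longrightarrow> t = u \<and> s' = s''"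
proof (induction arbitrary: u s'' rule: exec.induct)
  case (Seq c s t s' d t' s1)
  from Seq.prems show ?case
  proof (rule exec_SeqE)
    fix v r v'
    assume u: "u = v + v'" and c: "exec X c s v r" and d: "exec X d r v' s''"
    from Seq.IH(1)[OF c] have "t = v" "s' = r" by auto
    with Seq.IH(2)[of v' s''] d u show ?thesis by blast
  qed
next
  case (CondTrue b s c t s' d)
  from CondTrue.prems show ?case
    by (rule exec_CondE) (use CondTrue.hyps in \<open>auto dest: CondTrue.IH\<close>)
next
  case (CondFalse b s d t s' c)
  from CondFalse.prems show ?case
    by (rule exec_CondE) (use CondFalse.hyps in \<open>auto dest: CondFalse.IH\<close>)
next
  case (WhileFalse b s c)
  from WhileFalse.prems show ?case
    by (rule exec_WhileE) (use WhileFalse.hyps in simp_all)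
next
  case (WhileTrue b s c t s' t' s1)
  from WhileTrue.prems show ?case
  proof (rule exec_WhileE)
    assume "\<not> bval X b s"
    then show ?thesis using WhileTrue.hyps by simp
  next
    fix v r v'
    assume u: "u = Suc (bcost b + v + v')" and c: "exec X c s v r"
      and w: "exec X (While b c) r v' s''"
    from WhileTrue.IH(1)[OF c] have "t = v" "s' = r" by auto
    with WhileTrue.IH(2)[of v' s''] w u show ?thesis by auto
  qed
qed (auto elim: exec_SkipE exec_AssignE exec_StoreE exec_EmitE)

text \<open>
  Input of a list of \<open>n\<close> intervals: register \<open>0\<close> contains \<open>n\<close>, the lower and upper bound of the
  \<open>i\<close>-th interval are at the addresses \<open>2 * i\<close> and \<open>2 * i + 1\<close> of the real memory, and the kinds of
  these bounds (unbounded, closed, open) are at the same addresses of memory \<open>0\<close>. Everything else is zero.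
\<close>

fun bound_value :: "bound \<Rightarrow> real" where
  "bound_value Unbounded = 0"
| "bound_value (Closed a) = a"
| "bound_value (Open a) = a"

fun bound_kind :: "bound \<Rightarrow> nat" where
  "bound_kind Unbounded = 0"
| "bound_kind (Closed a) = 1"
| "bound_kind (Open a) = 2"

definition input_bound :: "(bound \<times> bound) list \<Rightarrow> nat \<Rightarrow> bound" where
  "input_bound Is j = (if even j then fst (Is ! (j div 2)) else snd (Is ! (j div 2)))"

definition input_reals :: "(bound \<times> bound) list \<Rightarrow> nat \<Rightarrow> real" where
  "input_reals Is j = (if j < 2 * length Is then bound_value (input_bound Is j) else 0)"

definition input_ram :: "(bound \<times> bound) list \<Rightarrow> ram" where
  "input_ram Is =
     \<lparr>reg = (\<lambda>_. 0)(0 := length Is),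
      mem = (\<lambda>_ _. 0)(0 := (\<lambda>j. if j < 2 * length Is then bound_kind (input_bound Is j) else 0)),
      tape = []\<rparr>"

end

theory Submission imports Defs "HOL-Library.Multiset" begin

text \<open>
  Sort the intervals by lower bound and insert them one by one into a list of active intervals. When
  \<open>j\<close> is inserted, first discard the active intervals that lie entirely to the left of \<open>j\<close>. The
  remaining ones and \<open>j\<close> have a common point (just after the lower bound of \<open>j\<close>), so the list has
  length \<open>m \<le> \<Delta>\<close>; write it out \<open>m\<close> times, which contains every permutation of every subset of it.
  In a realization, the points between two consecutive lower bounds belong to the intervals that are
  active in between, so the concatenation of the blocks contains every sorted order. Its length is at
  most \<open>n \<Delta>\<^sup>2\<close>, and apart from the initial merge sort the running time is linear in it.
\<close>

section \<open>Weakest preconditions with running time\<close>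

text \<open>Total correctness: \<open>exec\<close> is deterministic by
  \<open>exec_deterministic\<close>, so the run that exists is the only one. The time is an argument
  of \<open>Q\<close>, so that result and cost are proved in one induction.\<close>

definition wp :: "(nat \<Rightarrow> real) \<Rightarrow> com \<Rightarrow> (nat \<Rightarrow> ram \<Rightarrow> bool) \<Rightarrow> ram \<Rightarrow> bool" where
  "wp X c Q s \<longleftrightarrow> (\<exists>t s'. exec X c s t s' \<and> Q t s')"

lemma wp_mono: "wp X c P s \<Longrightarrow> (\<And>t s'. P t s' \<Longrightarrow> Q t s') \<Longrightarrow> wp X c Q s"
  unfolding wp_def by blast

lemma wp_Assign [simp]:
  "wp X (Assign r a) Q s \<longleftrightarrow> Q (acost a + 1) (s\<lparr>reg := (reg s)(r := aval a s)\<rparr>)"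
  unfolding wp_def by (auto elim: exec_AssignE intro: exec.Assign[simplified])

lemma wp_Skip [simp]: "wp X Skip Q s \<longleftrightarrow> Q 1 s"
  unfolding wp_def by (auto elim: exec_SkipE intro: exec.Skip[simplified])

lemma wp_Store [simp]:
  "wp X (Store m a b) Q s \<longleftrightarrow>
    Q (acost a + acost b + 1) (s\<lparr>mem := (mem s)(m := (mem s m)(aval a s := aval b s))\<rparr>)"
  unfolding wp_def by (auto elim: exec_StoreE intro: exec.Store[simplified])

lemma wp_Emit [simp]: "wp X (Emit a) Q s \<longleftrightarrow> Q (acost a + 1) (s\<lparr>tape := tape s @ [aval a s]\<rparr>)"
  unfolding wp_def by (auto elim: exec_EmitE intro: exec.Emit[simplified])

lemma wp_Seq [simp]: "wp X (Seq c d) Q s \<longleftrightarrow> wp X c (\<lambda>t. wp X d (\<lambda>t'. Q (t + t'))) s"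
  unfolding wp_def by (blast elim: exec_SeqE intro: exec.Seq)

lemma wp_Cond [simp]:
  "wp X (Cond b c d) Q s \<longleftrightarrow>
    (if bval X b s then wp X c (\<lambda>t. Q (bcost b + t + 1)) s else wp X d (\<lambda>t. Q (bcost b + t + 1)) s)"
proof -
  have "exec X (Cond b c d) s t s' \<longleftrightarrow>
      (\<exists>u. t = bcost b + u + 1 \<and> exec X (if bval X b s then c else d) s u s')" for t s'
    by (cases "bval X b s"; intro iffI; (erule exec_CondE)?)
      (auto intro: exec.CondTrue[simplified] exec.CondFalse[simplified])
  then show ?thesis unfolding wp_def by auto
qed

lemma wp_While:
  "wp X (While b c) Q s \<longleftrightarrow>
    (if bval X b s
     then wp X c (\<lambda>t. wp X (While b c) (\<lambda>t'. Q (bcost b + t + t' + 1))) s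
     else Q (bcost b + 1) s)"
proof -
  have "exec X (While b c) s t s' \<longleftrightarrow>
      (if bval X b s
       then \<exists>u r v. t = bcost b + u + v + 1 \<and> exec X c s u r \<and> exec X (While b c) r v s'
       else t = bcost b + 1 \<and> s' = s)" for t s'
  proof (cases "bval X b s")
    case True
    then show ?thesis
      by (auto dest: exec.WhileTrue) (erule exec_WhileE, simp, blast)
  next
    case False
    then show ?thesis by (auto elim: exec_WhileE intro: exec.WhileFalse[simplified])
  qed
  then show ?thesis unfolding wp_def by (cases "bval X b s") (simp_all, blast)
qed

section \<open>Merge sort on lists\<close>

fun merge_by :: "('a \<Rightarrow> 'a \<Rightarrow> bool) \<Rightarrow> 'a list \<Rightarrow> 'a list \<Rightarrow> 'a list" where
  "merge_by lt [] ys = ys"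
| "merge_by lt (x # xs) [] = x # xs"
| "merge_by lt (x # xs) (y # ys) =
    (if lt y x then y # merge_by lt (x # xs) ys else x # merge_by lt xs (y # ys))"

lemma mset_merge_by [simp]: "mset (merge_by lt xs ys) = mset xs + mset ys"
  by (induction lt xs ys rule: merge_by.induct) auto

lemma set_merge_by [simp]: "set (merge_by lt xs ys) = set xs \<union> set ys"
  by (metis mset_merge_by set_mset_mset set_mset_union)

lemma length_merge_by [simp]: "length (merge_by lt xs ys) = length xs + length ys"
  by (metis mset_merge_by size_mset size_union)

lemma merge_by_Nil2 [simp]: "merge_by lt xs [] = xs"
  by (cases xs) auto

abbreviation sorted_by :: "('a \<Rightarrow> 'a \<Rightarrow> bool) \<Rightarrow> 'a list \<Rightarrow> bool" where
  "sorted_by lt \<equiv> sorted_wrt (\<lambda>x y. \<not> lt y x)"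

text \<open>The two assumptions on \<open>lt\<close> make it a strict weak order, so the head that
  is chosen is minimal in both lists.\<close>

lemma sorted_by_merge_by:
  assumes asym: "\<And>x y. lt x y \<Longrightarrow> \<not> lt y x"
    and trans: "\<And>x y z. \<not> lt y x \<Longrightarrow> \<not> lt z y \<Longrightarrow> \<not> lt z x"
    and "sorted_by lt xs" "sorted_by lt ys"
  shows "sorted_by lt (merge_by lt xs ys)"
  using assms
proof (induction lt xs ys rule: merge_by.induct)
  case (1 lt ys)
  show ?case using "1.prems"(4) by simp
next
  case (2 lt x xs)
  show ?case using "2.prems"(3) by simp
next
  case (3 lt x xs y ys)
  note asym = "3.prems"(1) and trans = "3.prems"(2)
  show ?case
  proof (cases "lt y x")
    case True
    have "sorted_by lt (merge_by lt (x # xs) ys)"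
      by (rule "3.IH"(1)[OF True asym trans]) (use "3.prems"(3,4) in auto)
    \<comment> \<open>For \<open>z\<close> from \<open>xs\<close>, negative transitivity passes
      through \<open>x\<close>: \<open>y\<close> is strictly below \<open>x\<close>, and
      \<open>z\<close> is not below \<open>x\<close>.\<close>
    moreover have "\<not> lt z y" if "z \<in> insert x (set xs) \<union> set ys" for z
      using that "3.prems"(3,4) True by (auto dest: asym) (metis asym trans)
    ultimately show ?thesis using True by simp
  next
    case False
    have "sorted_by lt (merge_by lt xs (y # ys))"
      by (rule "3.IH"(2)[OF False asym trans]) (use "3.prems"(3,4) in auto)
    moreover have "\<not> lt z x" if "z \<in> set xs \<union> insert y (set ys)" for z
      using that "3.prems"(3,4) False by auto (metis trans)
    ultimately show ?thesis using False by simp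
  qed
qed

section \<open>Bottom-up merge passes\<close>

function merge_pass :: "('a \<Rightarrow> 'a \<Rightarrow> bool) \<Rightarrow> nat \<Rightarrow> 'a list \<Rightarrow> 'a list" where
  "merge_pass lt w xs =
    (if xs = [] \<or> w = 0 then []
     else merge_by lt (take w xs) (take w (drop w xs)) @ merge_pass lt w (drop (w + w) xs))"
  by auto
termination by (relation "Wellfounded.measure (\<lambda>(lt, w, xs). length xs)") auto

declare merge_pass.simps [simp del]

lemma mset_merge_pass: "0 < w \<Longrightarrow> mset (merge_pass lt w xs) = mset xs"
proof (induction lt w xs rule: merge_pass.induct)
  case (1 lt w xs)
  have "xs = take w xs @ take w (drop w xs) @ drop (w + w) xs"
    by (metis append_take_drop_id drop_drop)
  then have "mset xs = mset (take w xs) + mset (take w (drop w xs)) + mset (drop (w + w) xs)"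
    by (metis mset_append union_assoc)
  then show ?case
    using 1 by (subst merge_pass.simps) auto
qed

text \<open>No bound on \<open>q\<close> is necessary: a chunk past the end is empty, and the last
  one may be shorter than \<open>w\<close>.\<close>

definition sorted_chunks :: "('a \<Rightarrow> 'a \<Rightarrow> bool) \<Rightarrow> nat \<Rightarrow> 'a list \<Rightarrow> bool" where
  "sorted_chunks lt w xs \<longleftrightarrow> (\<forall>q. sorted_by lt (take w (drop (q * w) xs)))"

lemma sorted_chunks_1: "sorted_chunks lt 1 xs"
proof -
  have "sorted_by lt (take 1 ys)" for ys by (cases ys) auto
  then show ?thesis unfolding sorted_chunks_def by blast
qed

lemma sorted_chunks_drop: "sorted_chunks lt w xs \<Longrightarrow> sorted_chunks lt w (drop (w + w) xs)"
  unfolding sorted_chunks_def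
proof
  fix q
  assume "\<forall>q. sorted_by lt (take w (drop (q * w) xs))"
  from this[rule_format, of "q + 2"]
  show "sorted_by lt (take w (drop (q * w) (drop (w + w) xs)))"
    by (simp add: algebra_simps)
qed

text \<open>A merged block has length \<open>w + w\<close> unless it exhausts the list, so the
  chunks of the output are exactly the merged blocks.\<close>

lemma sorted_chunks_merge_pass:
  assumes asym: "\<And>x y. lt x y \<Longrightarrow> \<not> lt y x"
    and trans: "\<And>x y z. \<not> lt y x \<Longrightarrow> \<not> lt z y \<Longrightarrow> \<not> lt z x"
    and "0 < w" "sorted_chunks lt w xs"
  shows "sorted_chunks lt (w + w) (merge_pass lt w xs)"
  using assms(3,4)
proof (induction "length xs" arbitrary: xs rule: less_induct)
  case less
  show ?case
  proof (cases "xs = []")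
    case True
    then show ?thesis by (simp add: merge_pass.simps sorted_chunks_def)
  next
    case False
    define ms where "ms = merge_by lt (take w xs) (take w (drop w xs))"
    define rest where "rest = merge_pass lt w (drop (w + w) xs)"
    have eq: "merge_pass lt w xs = ms @ rest"
      using False less.prems by (subst merge_pass.simps) (simp add: ms_def rest_def)
    have IH: "sorted_chunks lt (w + w) rest"
      unfolding rest_def
      by (rule less.hyps) (use False less.prems in \<open>auto intro: sorted_chunks_drop\<close>)
    have "sorted_by lt (take w xs)" "sorted_by lt (take w (drop w xs))"
      using less.prems(2)[unfolded sorted_chunks_def, rule_format, of 0]
        less.prems(2)[unfolded sorted_chunks_def, rule_format, of 1] by simp_all
    then have ms: "sorted_by lt ms"
      unfolding ms_def using asym trans by (intro sorted_by_merge_by) blast+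
    have len: "length ms = min (w + w) (length xs)"
      unfolding ms_def by auto
    have rest: "rest = []" if "length ms < w + w"
      using that len by (simp add: rest_def merge_pass.simps)
    have "sorted_by lt (take (w + w) (drop (q * (w + w)) (ms @ rest)))" for q
    proof (cases q)
      case 0
      then show ?thesis using ms rest len by (cases "length ms < w + w") auto
    next
      case (Suc q')
      show ?thesis
      proof (cases "length ms < w + w")
        case True
        then show ?thesis using rest Suc by (simp add: algebra_simps)
      next
        case False
        then have "length ms = w + w" using len by auto
        then show ?thesis using IH Suc by (simp add: sorted_chunks_def)
      qed
    qed
    then show ?thesis unfolding eq sorted_chunks_def by blast
  qed
qed

section \<open>The sweep on lists\<close>

text \<open>The test is a parameter because the machine evaluates \<open>meets\<close> whereas the
  geometric argument uses \<open>bounds_meet\<close>; \<open>sweep_cong\<close> identifies the two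
  runs.\<close>

fun sweep :: "('a \<Rightarrow> 'a \<Rightarrow> bool) \<Rightarrow> 'a list \<Rightarrow> 'a list \<Rightarrow> 'a list" where
  "sweep meets act [] = []"
| "sweep meets act (j # js) =
    (let act' = filter (\<lambda>i. meets i j) act @ [j]
     in concat (replicate (length act') act') @ sweep meets act' js)"

text \<open>Each copy of \<open>xs\<close> supplies one entry of \<sigma>.\<close>

lemma subseq_concat_replicate:
  "set \<sigma> \<subseteq> set xs \<Longrightarrow> length \<sigma> \<le> k \<Longrightarrow> subseq \<sigma> (concat (replicate k xs))"
proof (induction \<sigma> arbitrary: k)
  case (Cons x \<sigma>)
  then obtain k' where k: "k = Suc k'" by (cases k) auto
  have "subseq [x] xs" using Cons.prems by (simp add: subseq_singleton_left)
  then have "subseq ([x] @ \<sigma>) (xs @ concat (replicate k' xs))"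
    using Cons k by (intro list_emb_append_mono) auto
  then show ?case using k by simp
qed simp

lemma subseq_concat_replicate_length:
  assumes "distinct \<sigma>" "set \<sigma> \<subseteq> set xs"
  shows "subseq \<sigma> (concat (replicate (length xs) xs))"
proof (rule subseq_concat_replicate[OF assms(2)])
  have "length \<sigma> = card (set \<sigma>)" using assms by (simp add: distinct_card)
  also have "\<dots> \<le> card (set xs)" using assms by (intro card_mono) auto
  also have "\<dots> \<le> length xs" by (rule card_length)
  finally show "length \<sigma> \<le> length xs" .
qed

lemma set_sweep: "set (sweep meets act js) \<subseteq> set act \<union> set js"
  by (induction meets act js rule: sweep.induct) (auto simp: Let_def split: if_splits)

section \<open>Correctness and length of the sweep\<close>

lemma above_upclosed: "x \<in> above b \<Longrightarrow> x \<le> y \<Longrightarrow> y \<in> above b"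
  by (cases b) auto

lemma below_linear: "below b \<subseteq> below c \<or> below c \<subseteq> below b"
  by (cases b; cases c) auto

text \<open>Rays in the same direction form a chain under inclusion. The least one provides the
  common point of the active intervals in \<open>length_sweep_le\<close>.\<close>

lemma exists_smallest_below:
  "xs \<noteq> [] \<Longrightarrow> \<exists>k\<in>set xs. \<forall>i\<in>set xs. below (u k) \<subseteq> below (u i)"
proof (induction xs)
  case (Cons x xs)
  show ?case
  proof (cases "xs = []")
    case False
    then obtain k where "k \<in> set xs" "\<forall>i\<in>set xs. below (u k) \<subseteq> below (u i)" using Cons by blast
    then show ?thesis using below_linear[of "u k" "u x"] by (auto 0 4)
  qed simp
qed simp

text \<open>Only one end of each interval matters: failure means that all of \<open>i\<close> lies
  to the left of \<open>j\<close>. For \<open>i = j\<close> the condition says that the interval is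
  nonempty.\<close>

definition bounds_meet :: "(nat \<Rightarrow> bound) \<Rightarrow> (nat \<Rightarrow> bound) \<Rightarrow> nat \<Rightarrow> nat \<Rightarrow> bool" where
  "bounds_meet l u i j \<longleftrightarrow> above (l j) \<inter> below (u i) \<noteq> {}"

text \<open>The points of a sorted order that lie left of the next lower bound all belong to currently
  active intervals, whatever their order, and the remaining ones are treated by the recursive call.\<close>

lemma subseq_sweep:
  assumes "sorted_wrt (\<lambda>i j. above (l j) \<subseteq> above (l i)) js"
    and "distinct \<sigma>" "sorted (map p \<sigma>)" "set \<sigma> \<subseteq> set act \<union> set js"
    and "\<And>x. x \<in> set \<sigma> \<Longrightarrow> p x \<in> above (l x) \<and> p x \<in> below (u x)"
    and "\<And>x. x \<in> set \<sigma> \<Longrightarrow> js \<noteq> [] \<and> p x \<in> above (l (hd js))"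
  shows "subseq \<sigma> (sweep (bounds_meet l u) act js)"
  using assms
proof (induction js arbitrary: act \<sigma>)
  case Nil
  \<comment> \<open>With no interval left, the last hypothesis fails for every entry of
    \<sigma>.\<close>
  then have "\<sigma> = []" by (cases \<sigma>) auto
  then show ?case by simp
next
  case (Cons j js)
  define act' where "act' = filter (\<lambda>i. bounds_meet l u i j) act @ [j]"
  \<comment> \<open>\<open>P x\<close> means that the point of \<open>x\<close> lies before the next
    lower bound, or that no interval is left to insert.\<close>
  define P where "P = (\<lambda>x. js = [] \<or> p x \<notin> above (l (hd js)))"
  define \<sigma>1 where "\<sigma>1 = takeWhile P \<sigma>"
  define \<sigma>2 where "\<sigma>2 = dropWhile P \<sigma>"
  have \<sigma>: "\<sigma> = \<sigma>1 @ \<sigma>2" by (simp add: \<sigma>1_def \<sigma>2_def)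
  have P1: "P x" if "x \<in> set \<sigma>1" for x using that set_takeWhileD unfolding \<sigma>1_def by metis
  have P2: "\<not> P x" if "x \<in> set \<sigma>2" for x
  proof -
    from that have ne: "\<sigma>2 \<noteq> []" by auto
    then have h: "\<not> P (hd \<sigma>2)" unfolding \<sigma>2_def by (rule hd_dropWhile)
    have "sorted (map p \<sigma>2)" using Cons.prems(3) \<sigma> by (simp add: sorted_append)
    \<comment> \<open>Points are sorted and lower rays are upward closed, so every point after the
      first one beyond the next lower bound is beyond it too.\<close>
    then have "p (hd \<sigma>2) \<le> p x" using that ne by (cases \<sigma>2) auto
    then show ?thesis using h above_upclosed unfolding P_def by blast
  qed
  \<comment> \<open>An interval whose point is still to come is not discarded: that point itself
    witnesses \<open>bounds_meet\<close>.\<close>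
  have act: "x \<in> set act'" if "x \<in> set \<sigma>" "x \<in> set act \<or> x = j" for x
    using that Cons.prems(5,6)[OF that(1)] by (auto simp: act'_def bounds_meet_def)
  \<comment> \<open>The lower ray of a later interval is contained in that of
    \<open>hd js\<close>.\<close>
  have js: "js \<noteq> [] \<and> p x \<in> above (l (hd js))" if "x \<in> set \<sigma>" "x \<in> set js" for x
    using that Cons.prems(1) Cons.prems(5)[OF that(1)] by (cases js) auto
  have "set \<sigma>1 \<subseteq> set act'"
  proof
    fix x
    assume x: "x \<in> set \<sigma>1"
    then have "x \<in> set \<sigma>" using \<sigma> by auto
    moreover from this have "x \<notin> set js" using js P1[OF x] by (auto simp: P_def)
    ultimately show "x \<in> set act'" using act Cons.prems(4) by auto
  qed
  then have 1: "subseq \<sigma>1 (concat (replicate (length act') act'))"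
    using Cons.prems(2) \<sigma> by (intro subseq_concat_replicate_length) auto
  have 2: "subseq \<sigma>2 (sweep (bounds_meet l u) act' js)"
  proof (rule Cons.IH)
    show "set \<sigma>2 \<subseteq> set act' \<union> set js" using act Cons.prems(4) \<sigma> by auto
    show "js \<noteq> [] \<and> p x \<in> above (l (hd js))" if "x \<in> set \<sigma>2" for x
      using P2[OF that] by (simp add: P_def)
  qed (use Cons.prems \<sigma> in \<open>auto simp: sorted_append\<close>)
  have "sweep (bounds_meet l u) act (j # js) =
      concat (replicate (length act') act') @ sweep (bounds_meet l u) act' js"
    by (simp add: act'_def Let_def)
  then show ?case
    using list_emb_append_mono[OF 1 2] \<sigma> by simp
qed

text \<open>The last hypothesis is the ply bound, stated for lists. Each updated active list has a
  common point, so it has at most \<Delta> entries and its block has at most \<Delta>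
  squared.\<close>

lemma length_sweep_le:
  assumes "sorted_wrt (\<lambda>i j. above (l j) \<subseteq> above (l i)) js"
    and "distinct (act @ js)"
    and "\<And>i j. i \<in> set act \<Longrightarrow> j \<in> set js \<Longrightarrow> above (l j) \<subseteq> above (l i)"
    and "\<And>j. j \<in> set js \<Longrightarrow> bounds_meet l u j j"
    and "\<And>xs x. distinct xs \<Longrightarrow> set xs \<subseteq> set act \<union> set js \<Longrightarrow>
        (\<And>i. i \<in> set xs \<Longrightarrow> x \<in> above (l i) \<inter> below (u i)) \<Longrightarrow> length xs \<le> \<Delta>"
  shows "length (sweep (bounds_meet l u) act js) \<le> length js * \<Delta>\<^sup>2"
  using assms
proof (induction js arbitrary: act)
  case (Cons j js)
  define act' where "act' = filter (\<lambda>i. bounds_meet l u i j) act @ [j]"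
  have sub: "set act' \<subseteq> set act \<union> {j}" by (auto simp: act'_def)
  have meets: "bounds_meet l u i j" if "i \<in> set act'" for i
    using that Cons.prems(4) by (auto simp: act'_def)
  have low: "above (l j) \<subseteq> above (l i)" if "i \<in> set act'" for i
    using that Cons.prems(3) by (auto simp: act'_def)
  have dist: "distinct act'" using Cons.prems(2) by (auto simp: act'_def)
  have len: "length act' \<le> \<Delta>"
  proof -
    \<comment> \<open>The common point is taken from the lower ray of \<open>j\<close>, the smallest
      one, and the smallest upper ray, that of \<open>k\<close>.\<close>
    obtain k where k: "k \<in> set act'" "\<forall>i\<in>set act'. below (u k) \<subseteq> below (u i)"
      using exists_smallest_below[of act' u] by (auto simp: act'_def)
    obtain x where "x \<in> above (l j)" "x \<in> below (u k)"
      using meets[OF k(1)] by (auto simp: bounds_meet_def)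
    then have "x \<in> above (l i) \<inter> below (u i)" if "i \<in> set act'" for i
      using low k that by blast
    moreover have "set act' \<subseteq> set act \<union> set (j # js)" using sub by auto
    ultimately show ?thesis using dist by (intro Cons.prems(5)[of act' x])
  qed
  have "length (sweep (bounds_meet l u) act' js) \<le> length js * \<Delta>\<^sup>2"
  proof (rule Cons.IH)
    show "distinct (act' @ js)" using Cons.prems(2) sub dist by auto
    show "above (l j') \<subseteq> above (l i)" if "i \<in> set act'" "j' \<in> set js" for i j'
      using low[OF that(1)] that Cons.prems(1) by auto
    show "length xs \<le> \<Delta>" if "distinct xs" "set xs \<subseteq> set act' \<union> set js"
      "\<And>i. i \<in> set xs \<Longrightarrow> x \<in> above (l i) \<inter> below (u i)" for xs x
      using that sub by (intro Cons.prems(5)[of xs x]) auto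
  qed (use Cons.prems in auto)
  moreover have "length act' * length act' \<le> \<Delta>\<^sup>2"
    using len by (simp add: power2_eq_square mult_le_mono)
  moreover have "length (sweep (bounds_meet l u) act (j # js)) =
      length act' * length act' + length (sweep (bounds_meet l u) act' js)"
    by (simp add: act'_def Let_def length_concat sum_list_replicate map_replicate)
  ultimately show ?case by simp
qed simp

section \<open>Comparing bounds on the machine\<close>

abbreviation Disj :: "bexp \<Rightarrow> bexp \<Rightarrow> bexp" where
  "Disj b c \<equiv> Neg (Conj (Neg b) (Neg c))"

text \<open>An unbounded lower end has kind 0 and precedes all others; a closed one (kind 1) precedes the
  open one (kind 2) with the same value.\<close>

definition low_less :: "(nat \<Rightarrow> real) \<Rightarrow> (nat \<Rightarrow> nat) \<Rightarrow> nat \<Rightarrow> nat \<Rightarrow> bool" where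
  "low_less X K i j \<longleftrightarrow> 0 < K (j + j) \<and>
     (K (i + i) < 1 \<or> X (i + i) < X (j + j) \<or>
      \<not> X (j + j) < X (i + i) \<and> K (i + i) < K (j + j))"

definition low_less_exp :: "aexp \<Rightarrow> aexp \<Rightarrow> bexp" where
  "low_less_exp a b = Conj (Less (Const 0) (Load 0 (Plus b b)))
     (Disj (Less (Load 0 (Plus a a)) (Const 1))
       (Disj (RLess (Plus a a) (Plus b b))
         (Conj (Neg (RLess (Plus b b) (Plus a a))) (Less (Load 0 (Plus a a)) (Load 0 (Plus b b))))))"

lemma bval_low_less_exp [simp]:
  "bval X (low_less_exp a b) s \<longleftrightarrow> low_less X (mem s 0) (aval a s) (aval b s)"
  by (simp add: low_less_exp_def low_less_def)

text \<open>This and \<open>low_less_cotrans\<close> are the order assumptions of the merge sort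
  lemmas; they hold for arbitrary memory contents.\<close>

lemma low_less_asym: "low_less X K i j \<Longrightarrow> \<not> low_less X K j i"
  unfolding low_less_def by auto

lemma low_less_cotrans: "\<not> low_less X K j i \<Longrightarrow> \<not> low_less X K k j \<Longrightarrow> \<not> low_less X K k i"
  unfolding low_less_def by linarith

text \<open>For two bounded ends with the same value, the sum of the kinds is below 3 iff both are closed.\<close>

definition meets :: "(nat \<Rightarrow> real) \<Rightarrow> (nat \<Rightarrow> nat) \<Rightarrow> nat \<Rightarrow> nat \<Rightarrow> bool" where
  "meets X K i j \<longleftrightarrow> K (j + j) < 1 \<or> K (i + i + 1) < 1 \<or> X (j + j) < X (i + i + 1) \<or>
     \<not> X (i + i + 1) < X (j + j) \<and> K (j + j) + K (i + i + 1) < 3"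

definition meets_exp :: "aexp \<Rightarrow> aexp \<Rightarrow> bexp" where
  "meets_exp a b = Disj (Less (Load 0 (Plus b b)) (Const 1))
     (Disj (Less (Load 0 (Plus (Plus a a) (Const 1))) (Const 1))
       (Disj (RLess (Plus b b) (Plus (Plus a a) (Const 1)))
         (Conj (Neg (RLess (Plus (Plus a a) (Const 1)) (Plus b b)))
           (Less (Plus (Load 0 (Plus b b)) (Load 0 (Plus (Plus a a) (Const 1)))) (Const 3)))))"

lemma bval_meets_exp [simp]:
  "bval X (meets_exp a b) s \<longleftrightarrow> meets X (mem s 0) (aval a s) (aval b s)"
  by (simp add: meets_exp_def meets_def)

lemma input_reals_low: "i < length Is \<Longrightarrow> input_reals Is (i + i) = bound_value (fst (Is ! i))"
  by (simp add: input_reals_def input_bound_def flip: mult_2)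

lemma input_reals_up: "i < length Is \<Longrightarrow> input_reals Is (i + i + 1) = bound_value (snd (Is ! i))"
  by (simp add: input_reals_def input_bound_def flip: mult_2)

lemma input_kind_low: "i < length Is \<Longrightarrow> mem (input_ram Is) 0 (i + i) = bound_kind (fst (Is ! i))"
  by (simp add: input_ram_def input_bound_def flip: mult_2)

lemma input_kind_up: "i < length Is \<Longrightarrow> mem (input_ram Is) 0 (i + i + 1) = bound_kind (snd (Is ! i))"
  by (simp add: input_ram_def input_bound_def flip: mult_2)

text \<open>Strict precedence is strict reverse inclusion of lower rays, since these form a chain.
  Density of the reals decides the inclusion of an open ray in another ray.\<close>

lemma low_less_input:
  assumes "i < length Is" "j < length Is"
  shows "low_less (input_reals Is) (mem (input_ram Is) 0) i j \<longleftrightarrow>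
    \<not> above (fst (Is ! i)) \<subseteq> above (fst (Is ! j))"
proof -
  have "\<not> UNIV \<subseteq> {a::real..}" "\<not> UNIV \<subseteq> {a::real<..}" for a
    using lt_ex[of a] by (auto simp: subset_eq not_le intro: exI[of _ a])
  moreover have "{a<..} \<subseteq> {b..} \<longleftrightarrow> b \<le> a" for a b :: real
    using dense[of a b] by (force simp: subset_eq not_le)
  moreover have "{a..} \<subseteq> {b<..} \<longleftrightarrow> b < a" for a b :: real by (auto simp: subset_eq)
  moreover have "{a<..} \<subseteq> {b<..} \<longleftrightarrow> b \<le> a" for a b :: real
    by (auto simp: subset_eq not_le intro: leI)
  ultimately show ?thesis
    using assms
    by (cases "fst (Is ! i)"; cases "fst (Is ! j)")
      (auto simp: low_less_def input_reals_low input_kind_low)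
qed

text \<open>Opposite rays ending at the same value meet only if both are closed; at different values
  density makes the kinds irrelevant.\<close>

lemma meets_input:
  assumes "i < length Is" "j < length Is"
  shows "meets (input_reals Is) (mem (input_ram Is) 0) i j \<longleftrightarrow>
    bounds_meet (\<lambda>k. fst (Is ! k)) (\<lambda>k. snd (Is ! k)) i j"
proof -
  have "{a..} \<inter> {..b} = {} \<longleftrightarrow> b < a" for a b :: real by auto
  moreover have "{a..} \<inter> {..<b} = {} \<longleftrightarrow> b \<le> a" for a b :: real by auto
  moreover have "{a<..} \<inter> {..b} = {} \<longleftrightarrow> b \<le> a" for a b :: real
    by (auto simp flip: greaterThanAtMost_def)
  moreover have "{a<..} \<inter> {..<b} = {} \<longleftrightarrow> b \<le> a" for a b :: real
    by (auto simp flip: greaterThanLessThan_def)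
  ultimately show ?thesis
    using assms
    by (cases "fst (Is ! j)"; cases "snd (Is ! i)")
      (auto simp: meets_def bounds_meet_def input_reals_low input_kind_low
        input_reals_up[simplified] input_kind_up[simplified])
qed

lemma bcost_low_less_exp [simp]: "bcost (low_less_exp a b) = 8 * acost a + 8 * acost b + 30"
  by (simp add: low_less_exp_def)

lemma bcost_meets_exp [simp]: "bcost (meets_exp a b) = 8 * acost a + 8 * acost b + 43"
  by (simp add: meets_exp_def)

section \<open>Sorting the intervals by their lower bounds\<close>

definition seg :: "(nat \<Rightarrow> 'a) \<Rightarrow> nat \<Rightarrow> nat \<Rightarrow> 'a list" where
  "seg f a b = map f [a..<b]"

lemma length_seg [simp]: "length (seg f a b) = b - a"
  by (simp add: seg_def)

lemma seg_empty [simp]: "b \<le> a \<Longrightarrow> seg f a b = []"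
  by (simp add: seg_def)

lemma seg_Cons: "a < b \<Longrightarrow> seg f a b = f a # seg f (Suc a) b"
  by (simp add: seg_def upt_conv_Cons)

lemma seg_Suc: "a \<le> b \<Longrightarrow> seg f a (Suc b) = seg f a b @ [f b]"
  by (simp add: seg_def)

lemma seg_upd [simp]: "k < a \<or> b \<le> k \<Longrightarrow> seg (f(k := v)) a b = seg f a b"
  by (auto simp: seg_def)

lemma seg_if [simp]: "k < a \<or> b \<le> k \<Longrightarrow> seg (\<lambda>x. if x = k then v else f x) a b = seg f a b"
  by (auto simp: seg_def)

lemma seg_cong: "(\<And>x. a \<le> x \<Longrightarrow> x < b \<Longrightarrow> f x = g x) \<Longrightarrow> seg f a b = seg g a b"
  by (simp add: seg_def)

lemma take_seg: "take w (seg f a b) = seg f a (min (a + w) b)"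
  by (cases "a + w \<le> b") (simp_all add: seg_def take_map min_def)

lemma drop_seg: "drop w (seg f a b) = seg f (a + w) b"
  by (simp add: seg_def drop_map)

text \<open>Registers: 0 number of intervals, 2 start of the array being sorted, 3 length of its sorted
  runs, 4 next free cell, 5 start and 6 end of the unmerged part, 7--8 and 9--10 the two runs
  being merged. Every pass writes its result behind the array it reads.\<close>

definition init_guard :: bexp where
  "init_guard = Less (Reg 2) (Reg 0)"

definition init_body :: com where
  "init_body = Seq (Store 2 (Reg 2) (Reg 2)) (Assign 2 (Plus (Reg 2) (Const 1)))"

definition merge_guard :: bexp where
  "merge_guard = Disj (Less (Reg 7) (Reg 8)) (Less (Reg 9) (Reg 10))"

text \<open>\<open>Conj\<close> is not short-circuit, so the comparison may read past a finished
  run. Memories are total, and the other conditions then decide the test.\<close>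

definition merge_body :: com where
  "merge_body =
    Seq (Cond (Conj (Less (Reg 9) (Reg 10))
                (Disj (Neg (Less (Reg 7) (Reg 8))) (low_less_exp (Load 2 (Reg 9)) (Load 2 (Reg 7)))))
          (Seq (Store 2 (Reg 4) (Load 2 (Reg 9))) (Assign 9 (Plus (Reg 9) (Const 1))))
          (Seq (Store 2 (Reg 4) (Load 2 (Reg 7))) (Assign 7 (Plus (Reg 7) (Const 1)))))
      (Assign 4 (Plus (Reg 4) (Const 1)))"

definition Min_exp :: "aexp \<Rightarrow> aexp \<Rightarrow> aexp" where
  "Min_exp a b = Minus a (Minus a b)"

lemma aval_Min_exp [simp]: "aval (Min_exp a b) s = min (aval a s) (aval b s)"
  by (simp add: Min_exp_def)

lemma acost_Min_exp [simp]: "acost (Min_exp a b) = 2 * acost a + acost b + 2"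
  by (simp add: Min_exp_def)

definition pass_guard :: bexp where
  "pass_guard = Less (Reg 5) (Reg 6)"

definition pass_body :: com where
  "pass_body =
    Seq (Assign 7 (Reg 5))
    (Seq (Assign 8 (Min_exp (Plus (Reg 5) (Reg 3)) (Reg 6)))
    (Seq (Assign 9 (Reg 8))
    (Seq (Assign 10 (Min_exp (Plus (Reg 8) (Reg 3)) (Reg 6)))
    (Seq (While merge_guard merge_body)
      (Assign 5 (Reg 10))))))"

definition sort_guard :: bexp where
  "sort_guard = Less (Reg 3) (Reg 0)"

definition sort_body :: com where
  "sort_body =
    Seq (Assign 4 (Plus (Reg 2) (Reg 0)))
    (Seq (Assign 5 (Reg 2))
    (Seq (Assign 6 (Reg 4))
    (Seq (While pass_guard pass_body)
    (Seq (Assign 2 (Reg 6))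
      (Assign 3 (Plus (Reg 3) (Reg 3)))))))"

text \<open>Bodies are unfolded only directly under \<open>wp\<close>. Inside \<open>While\<close>
  they stay folded, so the induction hypothesis still matches after one unrolling.\<close>

lemmas wp_bodies =
  arg_cong[OF init_body_def, of "\<lambda>c. wp X c Q s" for X Q s]
  arg_cong[OF merge_body_def, of "\<lambda>c. wp X c Q s" for X Q s]
  arg_cong[OF pass_body_def, of "\<lambda>c. wp X c Q s" for X Q s]
  arg_cong[OF sort_body_def, of "\<lambda>c. wp X c Q s" for X Q s]

lemmas guards =
  arg_cong[OF init_guard_def, of "\<lambda>b. bval X b s" for X s] arg_cong[OF init_guard_def, of bcost]
  arg_cong[OF merge_guard_def, of "\<lambda>b. bval X b s" for X s] arg_cong[OF merge_guard_def, of bcost]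
  arg_cong[OF pass_guard_def, of "\<lambda>b. bval X b s" for X s] arg_cong[OF pass_guard_def, of bcost]
  arg_cong[OF sort_guard_def, of "\<lambda>b. bval X b s" for X s] arg_cong[OF sort_guard_def, of bcost]

section \<open>Specifications of the sorting loops\<close>

lemma wp_init_loop:
  assumes "reg s 0 = reg s 2 + d" "seg (mem s 2) 0 (reg s 2) = [0..<reg s 2]"
  shows "wp X (While init_guard init_body) (\<lambda>t s'. t \<le> 20 * d + 10 \<and> reg s' 0 = reg s 0 \<and>
      seg (mem s' 2) 0 (reg s 0) = [0..<reg s 0] \<and> mem s' 0 = mem s 0 \<and> tape s' = tape s) s"
  using assms
proof (induction d arbitrary: s)
  case 0
  then show ?case by (subst wp_While) (simp add: guards)
next
  case (Suc d)
  \<comment> \<open>One iteration is unrolled and the induction hypothesis covers the rest; the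
    later loops follow this pattern.\<close>
  show ?case
    by (subst wp_While, simp add: guards wp_bodies Suc.prems, rule wp_mono[OF Suc.IH])
      (use Suc.prems in \<open>auto simp: seg_Suc\<close>)
qed

text \<open>The address \<open>e\<close> separates the runs being read from the output, so writing
  never destroys unread cells; \<open>d\<close> counts the entries left in both runs.\<close>

lemma wp_merge_loop:
  assumes "reg s 8 - reg s 7 + (reg s 10 - reg s 9) = d"
    and "reg s 8 \<le> e" "reg s 10 \<le> e" "e \<le> reg s 4"
  shows "wp X (While merge_guard merge_body) (\<lambda>t s'. t \<le> 100 * d + 20 \<and>
      seg (mem s' 2) e (reg s' 4) = seg (mem s 2) e (reg s 4) @
        merge_by (low_less X (mem s 0)) (seg (mem s 2) (reg s 7) (reg s 8)) (seg (mem s 2) (reg s 9) (reg s 10)) \<and>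
      reg s' 4 = reg s 4 + d \<and> (\<forall>x<e. mem s' 2 x = mem s 2 x) \<and> mem s' 0 = mem s 0 \<and> tape s' = tape s \<and>
      reg s' 0 = reg s 0 \<and> reg s' 2 = reg s 2 \<and> reg s' 3 = reg s 3 \<and>
      reg s' 6 = reg s 6 \<and> reg s' 10 = reg s 10) s"
  using assms
proof (induction d arbitrary: s)
  case 0
  then show ?case by (subst wp_While) (simp add: guards)
next
  case (Suc d)
  show ?case
  proof (cases "reg s 9 < reg s 10 \<and>
      (reg s 8 \<le> reg s 7 \<or> low_less X (mem s 0) (mem s 2 (reg s 9)) (mem s 2 (reg s 7)))")
    case True
    show ?thesis
      apply (subst wp_While)
      apply (use True in \<open>simp add: guards wp_bodies not_less\<close>)
      apply (rule wp_mono[OF Suc.IH])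
      using True Suc.prems
          apply (auto simp: seg_Cons[of "reg s 9"] seg_Suc[of e "reg s 4"])
      apply (cases "reg s 8 \<le> reg s 7"; simp add: seg_Cons[of "reg s 7"])
      done
  next
    case False
    then have 7: "reg s 7 < reg s 8" using Suc.prems(1) by auto
    have neg: "\<not> (reg s 9 < reg s 10 \<and> low_less X (mem s 0) (mem s 2 (reg s 9)) (mem s 2 (reg s 7)))"
      using False by blast
    show ?thesis
      apply (subst wp_While)
      apply (simp add: guards wp_bodies neg 7)
      apply (rule wp_mono[OF Suc.IH])
      using False 7 Suc.prems
          apply (auto simp: seg_Cons[of "reg s 7"] seg_Suc[of e "reg s 4"])
       apply (cases "reg s 10 \<le> reg s 9"; simp add: seg_Cons[of "reg s 9"])+
      done
  qed
qed

text \<open>Every block consumes at least one cell, so its fixed overhead is charged to its cells on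
  top of the 100 units each for merging.\<close>

lemma wp_pass_loop:
  assumes "reg s 5 \<le> reg s 6" "reg s 6 \<le> reg s 4" "0 < reg s 3"
  shows "wp X (While pass_guard pass_body) (\<lambda>t s'. t \<le> 150 * (reg s 6 - reg s 5) + 10 \<and>
      seg (mem s' 2) (reg s 6) (reg s' 4) = seg (mem s 2) (reg s 6) (reg s 4) @
        merge_pass (low_less X (mem s 0)) (reg s 3) (seg (mem s 2) (reg s 5) (reg s 6)) \<and>
      reg s' 4 = reg s 4 + (reg s 6 - reg s 5) \<and> mem s' 0 = mem s 0 \<and> tape s' = tape s \<and>
      reg s' 0 = reg s 0 \<and> reg s' 2 = reg s 2 \<and> reg s' 3 = reg s 3 \<and> reg s' 6 = reg s 6) s"
  using assms
proof (induction "reg s 6 - reg s 5" arbitrary: s rule: less_induct)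
  case less
  show ?case
  proof (cases "reg s 5 < reg s 6")
    case False
    then show ?thesis using less.prems
      by (subst wp_While) (simp add: guards merge_pass.simps)
  next
    case True
    define lo hi w where "lo = reg s 5" and "hi = reg s 6" and "w = reg s 3"
    define mid where "mid = min (lo + w) hi"
    define nxt where "nxt = min (mid + w) hi"
    note d = lo_def[symmetric] hi_def[symmetric] w_def[symmetric] mid_def[symmetric] nxt_def[symmetric]
    have lo: "lo < hi" "0 < w" "hi \<le> reg s 4" using True less.prems by (simp_all add: d)
    then have ord: "lo < mid" "mid \<le> nxt" "nxt \<le> hi" by (auto simp: mid_def nxt_def)
    have pass: "merge_pass lt w (seg f lo hi) =
        merge_by lt (seg f lo mid) (seg f mid nxt) @ merge_pass lt w (seg f nxt hi)" for f :: "nat \<Rightarrow> nat" and lt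
    proof -
      have "seg f (lo + w) (min (lo + w + w) hi) = seg f mid nxt"
        by (cases "lo + w \<le> hi") (auto simp: mid_def nxt_def)
      moreover have "seg f (lo + (w + w)) hi = seg f nxt hi"
        by (cases "lo + w + w \<le> hi") (auto simp: mid_def nxt_def add.assoc)
      moreover have "seg f lo hi \<noteq> []" using lo by (simp add: seg_Cons)
      ultimately show ?thesis using lo
        by (subst merge_pass.simps) (simp add: take_seg drop_seg mid_def)
    qed
    show ?thesis
      apply (subst wp_While)
      apply (use lo in \<open>simp add: guards wp_bodies d\<close>)
      apply (rule wp_mono[OF wp_merge_loop[where e = hi, OF refl]])
      subgoal using ord by (simp add: d)
      subgoal using ord by (simp add: d)
      subgoal using lo by (simp add: d)
      subgoal for t s1
        apply simp
        apply (rule wp_mono[OF less.hyps])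
        subgoal using ord lo by (simp add: d)
        subgoal using ord lo by (simp add: d)
        subgoal using ord lo by (simp add: d)
        subgoal using ord lo by (simp add: d)
        \<comment> \<open>Merging leaves the cells below \<open>hi\<close> unchanged, so the
          unmerged slice in \<open>s1\<close> is the one in \<open>s\<close>.\<close>
        subgoal for t' s2
          using ord lo seg_cong[of nxt hi "mem s1 2" "mem s 2"] by (auto simp: d pass)
        done
      done
  qed
qed

text \<open>Each pass doubles the run length, so \<open>d\<close> passes reach \<open>n\<close>. A
  pass is made only if \<open>n\<close> is positive, which lets its constant overhead be charged to
  the cells.\<close>

lemma wp_sort_loop:
  assumes "reg s 0 = n" "n \<le> reg s 3 * 2 ^ d" "0 < reg s 3"
    and "sorted_chunks (low_less X (mem s 0)) (reg s 3) (seg (mem s 2) (reg s 2) (reg s 2 + n))"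
  shows "wp X (While sort_guard sort_body) (\<lambda>t s'. t \<le> 200 * (d * n) + 10 \<and>
      mset (seg (mem s' 2) (reg s' 2) (reg s' 2 + n)) = mset (seg (mem s 2) (reg s 2) (reg s 2 + n)) \<and>
      sorted_by (low_less X (mem s 0)) (seg (mem s' 2) (reg s' 2) (reg s' 2 + n)) \<and>
      reg s' 0 = n \<and> mem s' 0 = mem s 0 \<and> tape s' = tape s) s"
  using assms
proof (induction d arbitrary: s)
  case 0
  then show ?case
    \<comment> \<open>The run length is at least \<open>n\<close>, so chunk 0 is the whole
      array.\<close>
    using "0.prems"(4)[unfolded sorted_chunks_def, rule_format, of 0]
    by (subst wp_While) (simp add: guards)
next
  case (Suc d)
  show ?case
  proof (cases "reg s 3 < n")
    case False
    then show ?thesis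
      using Suc.prems Suc.prems(4)[unfolded sorted_chunks_def, rule_format, of 0]
      by (subst wp_While) (simp add: guards)
  next
    case True
    let ?lt = "low_less X (mem s 0)"
    let ?xs = "seg (mem s 2) (reg s 2) (reg s 2 + n)"
    have chunks: "sorted_chunks ?lt (reg s 3 + reg s 3) (merge_pass ?lt (reg s 3) ?xs)"
      using Suc.prems by (intro sorted_chunks_merge_pass) (blast dest: low_less_asym low_less_cotrans)+
    have perm: "mset (merge_pass ?lt (reg s 3) ?xs) = mset ?xs"
      using Suc.prems by (intro mset_merge_pass)
    show ?thesis
      apply (subst wp_While)
      apply (use True Suc.prems(1) in \<open>simp add: guards wp_bodies\<close>)
      apply (rule wp_mono[OF wp_pass_loop])
      subgoal by simp
      subgoal by simp
      subgoal using Suc.prems by simp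
      subgoal for t s1
        apply simp
        apply (rule wp_mono[OF Suc.IH])
        subgoal using Suc.prems by simp
        subgoal using Suc.prems by (simp add: algebra_simps)
        subgoal using Suc.prems by simp
        subgoal using Suc.prems chunks by (auto simp: algebra_simps)
        subgoal for t' s2
          using True perm by auto
        done
      done
  qed
qed

section \<open>The sweep on the machine\<close>

text \<open>Registers: 4 position in the sorted array, 5 number of active intervals, which are kept in
  memory 3, 6 and 7 reading and writing position in memory 3, 8 new interval, 9 and 10 counters.\<close>

definition filter_guard :: bexp where
  "filter_guard = Less (Reg 6) (Reg 5)"

definition filter_body :: com where
  "filter_body =
    Seq (Cond (meets_exp (Load 3 (Reg 6)) (Reg 8))
          (Seq (Store 3 (Reg 7) (Load 3 (Reg 6))) (Assign 7 (Plus (Reg 7) (Const 1))))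
          Skip)
      (Assign 6 (Plus (Reg 6) (Const 1)))"

definition emit_guard :: bexp where
  "emit_guard = Less (Reg 10) (Reg 5)"

definition emit_body :: com where
  "emit_body = Seq (Emit (Load 3 (Reg 10))) (Assign 10 (Plus (Reg 10) (Const 1)))"

definition repeat_guard :: bexp where
  "repeat_guard = Less (Reg 9) (Reg 5)"

definition repeat_body :: com where
  "repeat_body =
    Seq (Assign 10 (Const 0))
    (Seq (While emit_guard emit_body)
      (Assign 9 (Plus (Reg 9) (Const 1))))"

definition sweep_guard :: bexp where
  "sweep_guard = Less (Reg 4) (Reg 0)"

definition sweep_body :: com where
  "sweep_body =
    Seq (Assign 8 (Load 2 (Plus (Reg 2) (Reg 4))))
    (Seq (Assign 6 (Const 0))
    (Seq (Assign 7 (Const 0))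
    (Seq (While filter_guard filter_body)
    (Seq (Store 3 (Reg 7) (Reg 8))
    (Seq (Assign 5 (Plus (Reg 7) (Const 1)))
    (Seq (Assign 9 (Const 0))
    (Seq (While repeat_guard repeat_body)
      (Assign 4 (Plus (Reg 4) (Const 1))))))))))"

lemmas wp_sweep_bodies =
  arg_cong[OF filter_body_def, of "\<lambda>c. wp X c Q s" for X Q s]
  arg_cong[OF emit_body_def, of "\<lambda>c. wp X c Q s" for X Q s]
  arg_cong[OF repeat_body_def, of "\<lambda>c. wp X c Q s" for X Q s]
  arg_cong[OF sweep_body_def, of "\<lambda>c. wp X c Q s" for X Q s]

lemmas sweep_guards =
  arg_cong[OF filter_guard_def, of "\<lambda>b. bval X b s" for X s] arg_cong[OF filter_guard_def, of bcost]
  arg_cong[OF emit_guard_def, of "\<lambda>b. bval X b s" for X s] arg_cong[OF emit_guard_def, of bcost]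
  arg_cong[OF repeat_guard_def, of "\<lambda>b. bval X b s" for X s] arg_cong[OF repeat_guard_def, of bcost]
  arg_cong[OF sweep_guard_def, of "\<lambda>b. bval X b s" for X s] arg_cong[OF sweep_guard_def, of bcost]

text \<open>Filtering in place is safe because the writing position never overtakes the reading
  position.\<close>

lemma wp_filter_loop:
  assumes "reg s 5 - reg s 6 = d" "reg s 7 \<le> reg s 6"
  shows "wp X (While filter_guard filter_body) (\<lambda>t s'. t \<le> 100 * d + 10 \<and>
      seg (mem s' 3) 0 (reg s' 7) = seg (mem s 3) 0 (reg s 7) @
        filter (\<lambda>i. meets X (mem s 0) i (reg s 8)) (seg (mem s 3) (reg s 6) (reg s 5)) \<and>
      mem s' 0 = mem s 0 \<and> mem s' 2 = mem s 2 \<and> tape s' = tape s \<and>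
      reg s' 0 = reg s 0 \<and> reg s' 2 = reg s 2 \<and> reg s' 4 = reg s 4 \<and> reg s' 8 = reg s 8) s"
  using assms
proof (induction d arbitrary: s)
  case 0
  then show ?case by (subst wp_While) (simp add: sweep_guards)
next
  case (Suc d)
  then have lt: "reg s 6 < reg s 5" by simp
  show ?case
  proof (cases "meets X (mem s 0) (mem s 3 (reg s 6)) (reg s 8)")
    case True
    show ?thesis
      by (subst wp_While, simp add: sweep_guards wp_sweep_bodies lt True, rule wp_mono[OF Suc.IH])
        (use Suc.prems lt True in \<open>auto simp: seg_Suc seg_Cons[of "reg s 6"]\<close>)
  next
    case False
    show ?thesis
      by (subst wp_While, simp add: sweep_guards wp_sweep_bodies lt False, rule wp_mono[OF Suc.IH])
        (use Suc.prems lt False in \<open>auto simp: seg_Cons[of "reg s 6"]\<close>)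
  qed
qed

lemma wp_emit_loop:
  assumes "reg s 5 - reg s 10 = d"
  shows "wp X (While emit_guard emit_body) (\<lambda>t s'. t \<le> 20 * d + 10 \<and>
      tape s' = tape s @ seg (mem s 3) (reg s 10) (reg s 5) \<and> mem s' = mem s \<and>
      (\<forall>r. r \<noteq> 10 \<longrightarrow> reg s' r = reg s r)) s"
  using assms
proof (induction d arbitrary: s)
  case 0
  then show ?case by (subst wp_While) (simp add: sweep_guards)
next
  case (Suc d)
  then have lt: "reg s 10 < reg s 5" by simp
  show ?case
    by (subst wp_While, simp add: sweep_guards wp_sweep_bodies lt, rule wp_mono[OF Suc.IH])
      (use Suc.prems lt in \<open>auto simp: seg_Cons[of "reg s 10"]\<close>)
qed

lemma wp_repeat_loop:
  assumes "reg s 5 - reg s 9 = d"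
  shows "wp X (While repeat_guard repeat_body) (\<lambda>t s'. t \<le> (20 * reg s 5 + 30) * d + 10 \<and>
      tape s' = tape s @ concat (replicate d (seg (mem s 3) 0 (reg s 5))) \<and> mem s' = mem s \<and>
      (\<forall>r. r \<noteq> 9 \<and> r \<noteq> 10 \<longrightarrow> reg s' r = reg s r)) s"
  using assms
proof (induction d arbitrary: s)
  case 0
  then show ?case by (subst wp_While) (simp add: sweep_guards)
next
  case (Suc d)
  then have lt: "reg s 9 < reg s 5" by simp
  show ?case
    apply (subst wp_While)
    apply (simp add: sweep_guards wp_sweep_bodies lt)
    apply (rule wp_mono[OF wp_emit_loop[OF refl]])
    apply simp
    apply (rule wp_mono[OF Suc.IH])
    using Suc.prems by (auto simp: algebra_simps)
qed

text \<open>The time is charged to the output: filtering the active list is paid by the block that was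
  written when the list was built.\<close>

lemma wp_sweep_loop:
  assumes "reg s 0 - reg s 4 = d"
  shows "wp X (While sweep_guard sweep_body) (\<lambda>t s'.
      tape s' = tape s @ sweep (meets X (mem s 0)) (seg (mem s 3) 0 (reg s 5))
        (seg (mem s 2) (reg s 2 + reg s 4) (reg s 2 + reg s 0)) \<and>
      t \<le> 100 * reg s 5 + 300 * (length (tape s') - length (tape s)) + 10) s"
  using assms
proof (induction d arbitrary: s)
  case 0
  then show ?case by (subst wp_While) (simp add: sweep_guards)
next
  case (Suc d)
  then have lt: "reg s 4 < reg s 0" by simp
  define j where "j = mem s 2 (reg s 2 + reg s 4)"
  define act where "act = seg (mem s 3) 0 (reg s 5)"
  define act' where "act' = filter (\<lambda>i. meets X (mem s 0) i j) act @ [j]"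
  have js: "seg (mem s 2) (reg s 2 + reg s 4) (reg s 2 + reg s 0) =
      j # seg (mem s 2) (Suc (reg s 2 + reg s 4)) (reg s 2 + reg s 0)"
    using lt by (simp add: seg_Cons j_def)
  have sw: "sweep (meets X (mem s 0)) act (j # js) =
      concat (replicate (length act') act') @ sweep (meets X (mem s 0)) act' js" for js
    by (simp add: act'_def Let_def)
  have pos: "1 \<le> length act'" by (simp add: act'_def)
  \<comment> \<open>Constant and linear costs can now be charged to the letters of the
    block.\<close>
  then have sq: "length act' \<le> length act' * length act'" by simp
  show ?case
    apply (subst wp_While)
    apply (simp add: sweep_guards wp_sweep_bodies lt)
    apply (rule wp_mono[OF wp_filter_loop[OF refl]])
    subgoal by simp
    subgoal premises p1 for t1 s1
    proof -
      \<comment> \<open>Memory 3 after the new interval has been stored behind the surviving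
        ones.\<close>
      let ?m = "(mem s1 3)(reg s1 7 := j)"
      have seg: "seg ?m 0 (Suc (reg s1 7)) = act'"
        using p1 by (simp add: seg_Suc act'_def act_def j_def)
      then have len: "Suc (reg s1 7) = length act'"
        by (metis length_seg minus_nat.diff_0)
      show ?thesis
        apply (use p1 in \<open>simp flip: j_def\<close>)
        apply (rule wp_mono[OF wp_repeat_loop[OF refl]])
        subgoal premises p2 for t2 s2
        proof -
          have tape2: "tape s2 = tape s @ concat (replicate (length act') act')"
            using p1 p2 seg len by (auto simp: fun_upd_def)
          show ?thesis
            apply simp
            apply (rule wp_mono[OF Suc.IH])
            subgoal using Suc.prems p1 p2 by simp
            subgoal premises p3 for t3 s3
            proof -
              have tape3: "tape s3 = tape s2 @ sweep (meets X (mem s 0)) act'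
                  (seg (mem s 2) (Suc (reg s 2 + reg s 4)) (reg s 2 + reg s 0))"
                using p1 p2 p3 seg len by (auto simp: fun_upd_def)
              have "t1 \<le> 100 * reg s 5 + 10" using p1 by auto
              moreover have "t2 \<le> 20 * (length act' * length act') + 30 * length act' + 10"
                using p2 len by (auto simp: algebra_simps)
              moreover have "t3 \<le> 100 * length act' + 300 * (length (tape s3) - length (tape s2)) + 10"
                using p2 p3 len by auto
              moreover have "length (tape s3) - length (tape s) =
                  length act' * length act' + (length (tape s3) - length (tape s2))"
                using tape2 tape3 by (simp add: length_concat sum_list_replicate map_replicate)
              \<comment> \<open>With m the length of \<open>act'\<close>, the cost beyond
                \<open>100 * reg s 5\<close> and the recursive output is at most 20 m^2 + 130 m +
                60, hence below the 300 m^2 units of this block. The 130 m contains the next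
                filtering.\<close>
              ultimately have "t1 + t2 + t3 + 30 \<le>
                  100 * reg s 5 + 300 * (length (tape s3) - length (tape s))"
                using sq pos by linarith
              moreover have "tape s3 = tape s @ sweep (meets X (mem s 0)) act
                  (seg (mem s 2) (reg s 2 + reg s 4) (reg s 2 + reg s 0))"
                unfolding js sw tape3 tape2 by simp
              ultimately show ?thesis by (simp flip: act_def)
            qed
            done
        qed
        done
    qed
    done
qed

section \<open>The whole algorithm\<close>

definition supersequence_program :: com where
  "supersequence_program =
    Seq (While init_guard init_body)
    (Seq (Assign 2 (Const 0))
    (Seq (Assign 3 (Const 1))
    (Seq (While sort_guard sort_body)
    (Seq (Assign 4 (Const 0))
    (Seq (Assign 5 (Const 0))
      (While sweep_guard sweep_body))))))"

lemma wp_supersequence_program: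
  assumes "length Is \<le> 2 ^ d"
  shows "wp (input_reals Is) supersequence_program (\<lambda>t s.
      (\<exists>js. mset js = mset [0..<length Is] \<and>
        sorted_by (low_less (input_reals Is) (mem (input_ram Is) 0)) js \<and>
        tape s = sweep (meets (input_reals Is) (mem (input_ram Is) 0)) [] js) \<and>
      t \<le> 20 * length Is + 200 * (d * length Is) + 300 * length (tape s) + 50) (input_ram Is)"
  unfolding supersequence_program_def
  apply simp
  apply (rule wp_mono[OF wp_init_loop[where d = "length Is"]])
  subgoal by (simp add: input_ram_def)
  subgoal by (simp add: input_ram_def)
  subgoal premises p1 for t1 s1
    apply simp
    apply (rule wp_mono[OF wp_sort_loop[where d = d and n = "length Is"]])
    subgoal using p1 by (simp add: input_ram_def)
    subgoal using assms by simp
    subgoal by simp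
    subgoal using sorted_chunks_1 by simp
    subgoal premises p2 for t2 s2
      apply simp
      apply (rule wp_mono[OF wp_sweep_loop[OF refl]])
      subgoal premises p3 for t3 s3
      proof -
        let ?js = "seg (mem s2 2) (reg s2 2) (reg s2 2 + length Is)"
        have init: "reg (input_ram Is) 0 = length Is" "tape (input_ram Is) = []"
          by (simp_all add: input_ram_def)
        have "mset ?js = mset [0..<length Is]" using p1 p2 init by auto
        moreover have "sorted_by (low_less (input_reals Is) (mem (input_ram Is) 0)) ?js"
          using p1 p2 by auto
        moreover have "tape s3 = sweep (meets (input_reals Is) (mem (input_ram Is) 0)) [] ?js"
          using p1 p2 p3 init by auto
        moreover have "t1 + t2 + t3 \<le> 20 * length Is + 200 * (d * length Is) + 300 * length (tape s3) + 30"
          using p1 p2 p3 init by auto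
        ultimately show ?thesis by auto
      qed
      done
    done
  done

section \<open>Ply, and correctness on encoded intervals\<close>

lemma card_le_ply: "card {i. i < n \<and> x \<in> R i} \<le> ply n R"
proof -
  have "card {i. i < n \<and> x \<in> R i} \<le> card {..<n}" for x
    by (intro card_mono) auto
  \<comment> \<open>There are infinitely many points but at most \<open>n + 1\<close> counts, so
    \<open>Max\<close> is taken over a finite set.\<close>
  then have "range (\<lambda>x. card {i. i < n \<and> x \<in> R i}) \<subseteq> {..n}" by auto
  then have "finite (range (\<lambda>x. card {i. i < n \<and> x \<in> R i}))"
    using finite_subset by blast
  then show ?thesis unfolding ply_def by (intro Max_ge) auto
qed

text \<open>Positive ply lets the terms linear in \<open>n\<close> be absorbed in the running time;
  for \<open>n = 1\<close> the logarithm vanishes and cannot do so.\<close>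

lemma ply_pos:
  assumes "0 < n" "R 0 \<noteq> {}"
  shows "1 \<le> ply n R"
proof -
  obtain x where "x \<in> R 0" using assms by blast
  then have "{0} \<subseteq> {i. i < n \<and> x \<in> R i}" using assms by auto
  then have "card {0::nat} \<le> card {i. i < n \<and> x \<in> R i}" by (intro card_mono) auto
  then show ?thesis using card_le_ply[of n x R] by simp
qed

lemma sweep_cong:
  "(\<And>i j. i \<in> set act \<union> set js \<Longrightarrow> j \<in> set js \<Longrightarrow> P i j = Q i j) \<Longrightarrow> sweep P act js = sweep Q act js"
proof (induction js arbitrary: act)
  case (Cons j js)
  have "filter (\<lambda>i. P i j) act = filter (\<lambda>i. Q i j) act"
    using Cons.prems by (intro filter_cong) auto
  moreover have "sweep P (filter (\<lambda>i. Q i j) act @ [j]) js = sweep Q (filter (\<lambda>i. Q i j) act @ [j]) js"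
    using Cons.prems by (intro Cons.IH) auto
  ultimately show ?case by (simp add: Let_def)
qed simp

text \<open>On encoded input the machine tests become inclusion and intersection of rays, to which
  \<open>subseq_sweep\<close> and \<open>length_sweep_le\<close> apply with no active
  interval.\<close>

lemma sweep_sorting_supersequence:
  fixes Is :: "(bound \<times> bound) list"
  defines "R \<equiv> (\<lambda>i. ivl_set (Is ! i))" and "n \<equiv> length Is"
  assumes ne: "\<And>i. i < n \<Longrightarrow> R i \<noteq> {}"
    and perm: "mset js = mset [0..<n]"
    and sorted: "sorted_by (low_less (input_reals Is) (mem (input_ram Is) 0)) js"
  defines "\<Xi> \<equiv> sweep (meets (input_reals Is) (mem (input_ram Is) 0)) [] js"
  shows "sorting_supersequence n R \<Xi>" and "length \<Xi> \<le> n * (ply n R)\<^sup>2"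
proof -
  define l u where "l = (\<lambda>k. fst (Is ! k))" and "u = (\<lambda>k. snd (Is ! k))"
  have R: "x \<in> R i \<longleftrightarrow> x \<in> above (l i) \<and> x \<in> below (u i)" for x i
    by (simp add: R_def ivl_set_def l_def u_def)
  have set: "set js = {..<n}" using mset_eq_setD[OF perm] by (simp add: atLeast0LessThan)
  have dist: "distinct js" using mset_eq_imp_distinct_iff[OF perm] by simp
  have len: "length js = n" using mset_eq_length[OF perm] by simp
  have srt: "sorted_wrt (\<lambda>i j. above (l j) \<subseteq> above (l i)) js"
    by (rule sorted_wrt_mono_rel[OF _ sorted])
      (use set in \<open>auto simp: low_less_input n_def l_def\<close>)
  have \<Xi>: "\<Xi> = sweep (bounds_meet l u) [] js"
    unfolding \<Xi>_def l_def u_def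
    by (rule sweep_cong) (use set in \<open>auto simp: meets_input n_def\<close>)
  show "sorting_supersequence n R \<Xi>"
    unfolding sorting_supersequence_def
  proof (intro conjI allI impI)
    show "set \<Xi> \<subseteq> {..<n}" using set_sweep[of _ "[]" js] set by (auto simp: \<Xi>)
    fix p \<sigma>
    assume "realization n R p \<and> sorted_order n p \<sigma>"
    then have p: "\<And>i. i < n \<Longrightarrow> p i \<in> above (l i) \<and> p i \<in> below (u i)"
      and \<sigma>: "distinct \<sigma>" "set \<sigma> = {..<n}" "sorted (map p \<sigma>)"
      by (auto simp: realization_def sorted_order_def R)
    \<comment> \<open>The head of \<open>js\<close> has the largest lower ray, so it contains every
      point of the realization.\<close>
    have hd: "js \<noteq> [] \<and> p x \<in> above (l (hd js))" if "x < n" for x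
    proof -
      have "x \<in> set js" using that set by simp
      then show ?thesis using srt p[OF that] by (cases js) auto
    qed
    show "subseq \<sigma> \<Xi>"
      unfolding \<Xi> using srt \<sigma> set p hd by (intro subseq_sweep[of l js \<sigma> p "[]" u]) auto
  qed
  have "length (sweep (bounds_meet l u) [] js) \<le> length js * (ply n R)\<^sup>2"
  proof (rule length_sweep_le[OF srt])
    show "bounds_meet l u j j" if "j \<in> set js" for j
      using ne[of j] that set R[of _ j] by (auto simp: bounds_meet_def)
    show "length xs \<le> ply n R" if xs: "distinct xs" "set xs \<subseteq> set [] \<union> set js"
      "\<And>i. i \<in> set xs \<Longrightarrow> x \<in> above (l i) \<inter> below (u i)" for xs x
    proof -
      have "set xs \<subseteq> {i. i < n \<and> x \<in> R i}" using xs set R by auto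
      then have "card (set xs) \<le> card {i. i < n \<and> x \<in> R i}" by (intro card_mono) auto
      then show ?thesis using card_le_ply[of n x R] distinct_card[OF xs(1)] by simp
    qed
  qed (use dist in auto)
  then show "length \<Xi> \<le> n * (ply n R)\<^sup>2" by (simp add: \<Xi> len)
qed

lemma program_correct:
  assumes "n = length Is" "R = (\<lambda>i. ivl_set (Is ! i))" "\<And>i. i < n \<Longrightarrow> R i \<noteq> {}"
  shows "\<exists>t s. exec (input_reals Is) supersequence_program (input_ram Is) t s \<and>
      sorting_supersequence n R (tape s) \<and> length (tape s) \<le> n * (ply n R)\<^sup>2 \<and>
      (n \<ge> 1 \<longrightarrow> real t \<le> 600 * (real n * ((real (ply n R))\<^sup>2 + log 2 (real n))))"
proof -
  \<comment> \<open>An upper bound for the number of merge passes; rounding up adds at most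
    one.\<close>
  define d where "d = nat \<lceil>log 2 (real n)\<rceil>"
  have d: "n \<le> 2 ^ d"
  proof (cases "n = 0")
    case False
    have "log 2 (real n) \<le> real d" unfolding d_def by linarith
    then have "real n \<le> 2 powr real d" using False by (simp add: log_le_iff)
    then have "real n \<le> real (2 ^ d)" by (simp add: powr_realpow)
    then show ?thesis by (simp only: of_nat_le_iff)
  qed simp
  obtain t s js where ex: "exec (input_reals Is) supersequence_program (input_ram Is) t s"
    and js: "mset js = mset [0..<length Is]"
      "sorted_by (low_less (input_reals Is) (mem (input_ram Is) 0)) js"
    and tape: "tape s = sweep (meets (input_reals Is) (mem (input_ram Is) 0)) [] js"
    and t: "t \<le> 20 * n + 200 * (d * n) + 300 * length (tape s) + 50"
    using wp_supersequence_program[of Is d] d assms(1) unfolding wp_def by blast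
  have sup: "sorting_supersequence n R (tape s)" and len: "length (tape s) \<le> n * (ply n R)\<^sup>2"
    using sweep_sorting_supersequence[of Is js] js assms unfolding tape by auto
  have "real t \<le> 600 * (real n * ((real (ply n R))\<^sup>2 + log 2 (real n)))" if n: "n \<ge> 1"
  proof -
    have "1 \<le> ply n R" using n assms(3) by (intro ply_pos) auto
    then have "1 \<le> (ply n R)\<^sup>2" by simp
    then have np: "n \<le> n * (ply n R)\<^sup>2" by simp
    have "0 \<le> log 2 (real n)" using n by simp
    then have "real d \<le> log 2 (real n) + 1" unfolding d_def by linarith
    then have "real d * real n \<le> (log 2 (real n) + 1) * real n" by (intro mult_right_mono) auto
    then have dn: "real (d * n) \<le> real n * log 2 (real n) + real n" by (simp add: algebra_simps)
    have "real t \<le> 20 * real n + 200 * real (d * n) + 300 * real (n * (ply n R)\<^sup>2) + 50 * real n"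
      using t len n by linarith
    \<comment> \<open>The 270 collects 20, the 50 from the additive constant, and 200 for the
      rounded-up pass.\<close>
    also have "\<dots> \<le> 270 * real n + 200 * (real n * log 2 (real n)) + 300 * real (n * (ply n R)\<^sup>2)"
      using dn by linarith
    also have "\<dots> \<le> 600 * (real n * log 2 (real n)) + 600 * real (n * (ply n R)\<^sup>2)"
    proof -
      have "real n \<le> real (n * (ply n R)\<^sup>2)" using np by (simp only: of_nat_le_iff)
      moreover have "0 \<le> real n * log 2 (real n)" using \<open>0 \<le> log 2 (real n)\<close> by simp
      ultimately show ?thesis by linarith
    qed
    also have "\<dots> = 600 * (real n * ((real (ply n R))\<^sup>2 + log 2 (real n)))"
      by (simp add: algebra_simps)
    finally show ?thesis .
  qed
  then show ?thesis using ex sup len by blast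
qed

theorem theorem2:
  "\<exists>C::real.
     (\<forall>(n::nat) (R :: nat \<Rightarrow> real set).
        (\<forall>i<n. is_interval (R i) \<and> R i \<noteq> {}) \<longrightarrow>
        (\<exists>\<Xi>. sorting_supersequence n R \<Xi> \<and>
             real (length \<Xi>) \<le> C * (real n * (real (ply n R))\<^sup>2))) \<and>
     (\<exists>prog. \<forall>(Is :: (bound \<times> bound) list) n R.
        n = length Is \<and> R = (\<lambda>i. ivl_set (Is ! i)) \<and> (\<forall>i<n. R i \<noteq> {}) \<longrightarrow>
        (\<exists>t s. exec (input_reals Is) prog (input_ram Is) t s \<and>
           sorting_supersequence n R (tape s) \<and>
           real (length (tape s)) \<le> C * (real n * (real (ply n R))\<^sup>2) \<and>
           (n \<ge> 1 \<longrightarrow> real t \<le> C * (real n * ((real (ply n R))\<^sup>2 + log 2 (real n))))))"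
\<comment> \<open>The constant 600 is needed for the time; the length bounds hold with constant
  1.\<close>
proof (intro exI[of _ "600::real"] conjI allI impI exI[of _ supersequence_program])
  fix n :: nat and R :: "nat \<Rightarrow> real set"
  assume R: "\<forall>i<n. is_interval (R i) \<and> R i \<noteq> {}"
  \<comment> \<open>Existence for arbitrary intervals follows from the program, since every nonempty
    interval has a description by bounds.\<close>
  then have "\<forall>i. \<exists>I. i < n \<longrightarrow> R i = ivl_set I" using is_interval_imp_ivl_set by blast
  then obtain I where I: "\<And>i. i < n \<Longrightarrow> R i = ivl_set (I i)" by metis
  define Is where "Is = map I [0..<n]"
  define R' where "R' = (\<lambda>i. ivl_set (Is ! i))"
  have R': "R' i = R i" if "i < n" for i using that I by (simp add: R'_def Is_def)
  have "n = length Is" by (simp add: Is_def)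
  then obtain \<Xi> where \<Xi>: "sorting_supersequence n R' \<Xi>" "length \<Xi> \<le> n * (ply n R')\<^sup>2"
    using program_correct[of n Is R'] R R' R'_def by auto
  \<comment> \<open>\<open>R'\<close> and \<open>R\<close> agree only below \<open>n\<close>, which
    is all that ply and realizations depend on.\<close>
  have "{i. i < n \<and> x \<in> R' i} = {i. i < n \<and> x \<in> R i}" for x using R' by auto
  then have ply: "ply n R' = ply n R" by (simp add: ply_def)
  have "sorting_supersequence n R \<Xi>"
    using \<Xi>(1) R' by (simp add: sorting_supersequence_def realization_def)
  moreover have "real (length \<Xi>) \<le> 600 * (real n * (real (ply n R))\<^sup>2)"
    using \<Xi>(2) unfolding ply by (simp flip: of_nat_mult of_nat_power)
  ultimately show "\<exists>\<Xi>. sorting_supersequence n R \<Xi> \<and>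
      real (length \<Xi>) \<le> 600 * (real n * (real (ply n R))\<^sup>2)" by blast
next
  fix Is :: "(bound \<times> bound) list" and n and R
  assume "n = length Is \<and> R = (\<lambda>i. ivl_set (Is ! i)) \<and> (\<forall>i<n. R i \<noteq> {})"
  then obtain t s where "exec (input_reals Is) supersequence_program (input_ram Is) t s"
      "sorting_supersequence n R (tape s)" and len: "length (tape s) \<le> n * (ply n R)\<^sup>2"
      and "n \<ge> 1 \<longrightarrow> real t \<le> 600 * (real n * ((real (ply n R))\<^sup>2 + log 2 (real n)))"
    using program_correct[of n Is R] by blast
  moreover have "real (length (tape s)) \<le> 600 * (real n * (real (ply n R))\<^sup>2)"
    using len by (simp flip: of_nat_mult of_nat_power)
  ultimately show "\<exists>t s. exec (input_reals Is) supersequence_program (input_ram Is) t s \<and>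
      sorting_supersequence n R (tape s) \<and>
      real (length (tape s)) \<le> 600 * (real n * (real (ply n R))\<^sup>2) \<and>
      (n \<ge> 1 \<longrightarrow> real t \<le> 600 * (real n * ((real (ply n R))\<^sup>2 + log 2 (real n))))" by blast
qed

end
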